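(* Let $L\in\mathbb{R}^{m\times n}$ be nonzero, $A:\mathbb{R}^n\rightrightarrows\mathbb{R}^n$ and $B:\mathbb{R}^m\rightrightarrows\mathbb{R}^m$. Suppose that there exist a nonempty set $\mathcal S^\star\subseteq\operatorname{zer}T_{\rm PD}$ and symmetric matrices $R_A,R_A',R_B\in\mathbb{R}^{n\times n}$ and $M_A,M_B,M_B'\in\mathbb{R}^{m\times m}$ such that for every $z^\star=(x^\star,y^\star)\in\mathcal S^\star$ the following hold: (i) $\operatorname{range}R_A\subseteq\operatorname{range}L^\top$, $\operatorname{range}R_A'\subseteq\ker L$, $\operatorname{range}M_B\subseteq\operatorname{range}L$ and $\operatorname{range}M_B'\subseteq\ker L^\top$; (ii) $(M_A,M_B)\in\operatorname{dom}_\Box$ and $(R_A,R_B)\in\operatorname{dom}_\Box$; (iii) $A$ is $(L^\top M_AL,\;R_A+R_A')$-semimonotone at $(x^\star,-L^\top y^\star)\in\operatorname{gph}A$; (iv) $B$ is $(M_B+M_B',\;LR_BL^\top)$-semimonotone at $(Lx^\star,y^\star)\in\operatorname{gph}B$. Then $T_{\rm PD}$ has $\bigl((R_A\Box R_B+R_A')\oplus(M_A\Box M_B+M_B')\bigr)$-oblique weak Minty solutions at $\mathcal S^\star$.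
   Context: For a set-valued operator $A$: $\operatorname{gph}A=\{(x,y):y\in Ax\}$, $\operatorname{zer}A=\{x:0\in Ax\}$, $A^{-1}$ is the inverse relation. $T_{\rm PD}(x,y)=(Ax+L^\top y)\times(B^{-1}y-Lx)$ on $\mathbb{R}^{n+m}$; $(x,y)\in\operatorname{zer}T_{\rm PD}$ iff $(x,-L^\top y)\in\operatorname{gph}A$ and $(Lx,y)\in\operatorname{gph}B$. For symmetric (possibly indefinite) $M,R$, an operator $A$ is $(M,R)$-semimonotone at $(x',y')\in\operatorname{gph}A$ if $\langle x-x',y-y'\rangle\ge\langle x-x',M(x-x')\rangle+\langle y-y',R(y-y')\rangle$ for all $(x,y)\in\operatorname{gph}A$. For symmetric $V$, $T$ has $V$-oblique weak Minty solutions at a nonempty $\mathcal S^\star\subseteq\operatorname{zer}T$ if $\langle v,z-z^\star\rangle\ge\langle v,Vv\rangle$ for all $z^\star\in\mathcal S^\star$, $(z,v)\in\operatorname{gph}T$. Symmetric matrices $X,Y$ of the same size are parallel summable if $\operatorname{range}X\subseteq\operatorname{range}(X+Y)$ (equivalently $\operatorname{range}Y\subseteq\operatorname{range}(X+Y)$); then $X\Box Y:=X(X+Y)^\dagger Y$, with $\dagger$ the Moore--Penrose pseudoinverse. $\operatorname{dom}_\Box$ is the set of pairs $(X,Y)$ of symmetric, parallel summable matrices with $X+Y\succeq0$. $\oplus$ is the block-diagonal direct sum. *)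

theory Defs
  imports "HOL-Analysis.Analysis"
begin

section \<open>Set-valued operators\<close>

definition gph :: "('a \<Rightarrow> 'b set) \<Rightarrow> ('a \<times> 'b) set"
  where "gph A = {(x, y). y \<in> A x}"

definition zer :: "('a \<Rightarrow> 'b::zero set) \<Rightarrow> 'a set"
  where "zer A = {x. 0 \<in> A x}"

definition inv_op :: "('a \<Rightarrow> 'b set) \<Rightarrow> 'b \<Rightarrow> 'a set"
  where "inv_op A y = {x. y \<in> A x}"


section \<open>Matrices\<close>

definition symmetric_matrix :: "real^'n^'n \<Rightarrow> bool"
  where "symmetric_matrix X \<longleftrightarrow> transpose X = X"

definition psd :: "real^'n^'n \<Rightarrow> bool"
  where "psd X \<longleftrightarrow> symmetric_matrix X \<and> (\<forall>x. 0 \<le> x \<bullet> (X *v x))"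

definition mrange :: "real^'n^'m \<Rightarrow> (real^'m) set"
  where "mrange X = range (\<lambda>x. X *v x)"

definition mker :: "real^'n^'m \<Rightarrow> (real^'n) set"
  where "mker X = {x. X *v x = 0}"

text \<open>The four Penrose equations.\<close>

definition is_pinv :: "real^'n^'m \<Rightarrow> real^'m^'n \<Rightarrow> bool"
  where "is_pinv X P \<longleftrightarrow>
    X ** P ** X = X \<and> P ** X ** P = P \<and>
    transpose (X ** P) = X ** P \<and> transpose (P ** X) = P ** X"

definition pinv :: "real^'n^'m \<Rightarrow> real^'m^'n"
  where "pinv X = (THE P. is_pinv X P)"

lemma is_pinv_unique:
  assumes "is_pinv X P" and "is_pinv X Q"
  shows "P = Q"
proof -
  have p: "X ** P ** X = X" "P ** X ** P = P" "transpose (X ** P) = X ** P"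
      "transpose (P ** X) = P ** X"
    and q: "X ** Q ** X = X" "Q ** X ** Q = Q" "transpose (X ** Q) = X ** Q"
      "transpose (Q ** X) = Q ** X"
    using assms by (auto simp: is_pinv_def)
  have "X ** P = transpose ((X ** Q ** X) ** P)" using p q by simp
  also have "\<dots> = transpose ((X ** Q) ** (X ** P))" by (simp add: matrix_mul_assoc)
  also have "\<dots> = (X ** P) ** (X ** Q)" by (subst matrix_transpose_mul) (simp only: p q)
  also have "\<dots> = (X ** P ** X) ** Q" by (simp add: matrix_mul_assoc)
  finally have 1: "X ** P = X ** Q" using p by simp
  have "P ** X = transpose (P ** (X ** Q ** X))" using p q by simp
  also have "\<dots> = transpose ((P ** X) ** (Q ** X))" by (simp add: matrix_mul_assoc)
  also have "\<dots> = (Q ** X) ** (P ** X)" by (subst matrix_transpose_mul) (simp only: p q)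
  also have "\<dots> = Q ** (X ** P ** X)" by (simp add: matrix_mul_assoc)
  finally have 2: "P ** X = Q ** X" using p by simp
  have "P = P ** X ** P" using p by simp
  also have "\<dots> = Q ** (X ** P)" by (simp add: 2 matrix_mul_assoc)
  also have "\<dots> = Q ** X ** Q" by (simp add: 1 matrix_mul_assoc)
  finally show ?thesis using q by simp
qed

lemma is_pinv_exists:
  fixes X :: "real^'n^'m"
  shows "\<exists>P. is_pinv X P"
proof -
  have adj: "(X *v u) \<bullet> w = u \<bullet> (transpose X *v w)" for u w
    by (metis dot_lmul_matrix inner_commute transpose_matrix_vector)
  define good where "good y x \<longleftrightarrow>
    x \<in> range (\<lambda>u. transpose X *v u) \<and> (\<forall>w. (y - X *v x) \<bullet> (X *v w) = 0)" for y x
  have lin: "subspace (range (\<lambda>u. (M::real^'a^'b) *v u))" for M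
    by (intro linear_subspace_image) auto
  have ex: "\<exists>x. good y x" for y
  proof -
    obtain a z where a: "a \<in> span (range (\<lambda>u. X *v u))"
      and z: "\<And>w. w \<in> span (range (\<lambda>u. X *v u)) \<Longrightarrow> orthogonal z w" and y: "y = a + z"
      using orthogonal_subspace_decomp_exists by blast
    obtain x0 where x0: "a = X *v x0" using a lin[of X] by (auto simp: span_eq_iff[THEN iffD2])
    obtain b k where b: "b \<in> span (range (\<lambda>u. transpose X *v u))"
      and k: "\<And>w. w \<in> span (range (\<lambda>u. transpose X *v u)) \<Longrightarrow> orthogonal k w"
      and x: "x0 = b + k"
      using orthogonal_subspace_decomp_exists by blast
    have bb: "b \<in> range (\<lambda>u. transpose X *v u)"
      using b lin[of "transpose X"] by (metis span_eq_iff)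
    have "k \<bullet> (transpose X *v (X *v k)) = 0"
      using k[of "transpose X *v (X *v k)"] by (simp add: orthogonal_def span_base)
    then have "X *v k = 0" by (metis adj inner_eq_zero_iff)
    then have "y - X *v b = z" by (simp add: y x0 x matrix_vector_right_distrib)
    moreover have "z \<bullet> (X *v w) = 0" for w
      using z[of "X *v w"] by (simp add: orthogonal_def span_base)
    ultimately have "good y b" using bb by (simp add: good_def)
    then show ?thesis ..
  qed
  have uniq: "x = x'" if g: "good y x" "good y x'" for y x x'
  proof -
    have "(X *v (x - x')) \<bullet> (X *v (x - x')) =
        (y - X *v x') \<bullet> (X *v (x - x')) - (y - X *v x) \<bullet> (X *v (x - x'))"
      by (simp add: matrix_vector_mult_diff_distrib inner_diff_left)
    also have "\<dots> = 0" using g by (simp add: good_def)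
    finally have "X *v (x - x') = 0" by simp
    moreover obtain u where "x - x' = transpose X *v u"
      using g subspace_diff[OF lin[of "transpose X"], of x x'] by (auto simp: good_def)
    ultimately have "(x - x') \<bullet> (x - x') = 0" by (metis adj inner_zero_left)
    then show ?thesis by simp
  qed
  define p where "p y = (SOME x. good y x)" for y
  have gp: "good y (p y)" for y unfolding p_def by (rule someI_ex[OF ex])
  have peq: "p y = x" if "good y x" for x y using uniq gp that by blast
  have linp: "linear p"
  proof (rule linearI)
    fix a b
    have "good (a + b) (p a + p b)"
      using gp[of a] gp[of b] subspace_add[OF lin[of "transpose X"], of "p a" "p b"]
      by (auto simp: good_def matrix_vector_right_distrib inner_diff_left inner_add_left)
    then show "p (a + b) = p a + p b" by (rule peq)
  next
    fix c :: real and a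
    have "good (c *\<^sub>R a) (c *\<^sub>R p a)"
      using gp[of a] subspace_scale[OF lin[of "transpose X"], of "p a" c]
      by (auto simp: good_def matrix_vector_mult_scaleR inner_diff_left)
    then show "p (c *\<^sub>R a) = c *\<^sub>R p a" by (rule peq)
  qed
  define P where "P = matrix p"
  have Pp: "P *v y = p y" for y using linp by (simp add: P_def matrix_works)
  have orth: "(X *v p y) \<bullet> (X *v w) = y \<bullet> (X *v w)" for y w
    using gp[of y] by (simp add: good_def inner_diff_left)
  have xpx: "X *v p (X *v x) = X *v x" for x
  proof -
    have "(X *v (p (X *v x) - x)) \<bullet> (X *v (p (X *v x) - x)) = 0"
      using orth[of "X *v x"] by (simp add: matrix_vector_mult_diff_distrib inner_diff_left inner_diff_right)
    then show ?thesis by (simp add: matrix_vector_mult_diff_distrib)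
  qed
  have pxp: "p (X *v p y) = p y" for y
    using gp[of y] by (intro peq) (auto simp: good_def)
  have sym: "transpose M = M" if "\<And>u w. (M *v u) \<bullet> w = u \<bullet> (M *v w)" for M :: "real^'k^'k"
  proof -
    have "(transpose M *v w) \<bullet> u = (M *v w) \<bullet> u" for u w
      by (metis that dot_lmul_matrix transpose_matrix_vector)
    then have "transpose M *v w = M *v w" for w by (metis vector_eq_ldot inner_commute)
    then show ?thesis by (simp add: matrix_eq)
  qed
  have "((X ** P) *v u) \<bullet> w = u \<bullet> ((X ** P) *v w)" for u w
    using orth[of u "p w"] orth[of w "p u"]
    by (simp add: Pp inner_commute flip: matrix_vector_mul_assoc)
  moreover have "((P ** X) *v u) \<bullet> w = u \<bullet> ((P ** X) *v w)" for u w
  proof -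
    have h: "p (X *v u) \<bullet> w = p (X *v u) \<bullet> p (X *v w)" for u w
    proof -
      obtain v where v: "p (X *v u) = transpose X *v v" using gp[of "X *v u"] by (auto simp: good_def)
      have "p (X *v u) \<bullet> w = (X *v w) \<bullet> v" by (metis v adj inner_commute)
      also have "\<dots> = (X *v p (X *v w)) \<bullet> v" by (simp add: xpx)
      also have "\<dots> = p (X *v u) \<bullet> p (X *v w)" by (metis v adj inner_commute)
      finally show ?thesis .
    qed
    show ?thesis using h[of u w] h[of w u]
      by (simp add: Pp inner_commute flip: matrix_vector_mul_assoc)
  qed
  ultimately have "transpose (X ** P) = X ** P" "transpose (P ** X) = P ** X"
    using sym by blast+
  moreover have "X ** P ** X = X" "P ** X ** P = P"
    by (simp_all add: matrix_eq Pp xpx pxp flip: matrix_vector_mul_assoc)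
  ultimately show ?thesis unfolding is_pinv_def by blast
qed

lemma is_pinv_pinv: "is_pinv X (pinv X)"
  unfolding pinv_def by (rule theI') (use is_pinv_exists is_pinv_unique in blast)

definition parallel_summable :: "real^'n^'n \<Rightarrow> real^'n^'n \<Rightarrow> bool"
  where "parallel_summable X Y \<longleftrightarrow> mrange X \<subseteq> mrange (X + Y)"

text \<open>Only meaningful for symmetric, parallel summable arguments.\<close>

definition parallel_sum :: "real^'n^'n \<Rightarrow> real^'n^'n \<Rightarrow> real^'n^'n"  (infixl \<open>\<box>\<close> 70)
  where "X \<box> Y = X ** pinv (X + Y) ** Y"

definition dom_box :: "((real^'n^'n) \<times> (real^'n^'n)) set"
  where "dom_box = {(X, Y). symmetric_matrix X \<and> symmetric_matrix Y \<and>
    parallel_summable X Y \<and> psd (X + Y)}"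


section \<open>The product space\<close>

text \<open>The sum type \<open>'n + 'm\<close> indexes \<open>\<real>\<^bsup>n+m\<^esup>\<close>: \<open>Inl\<close> marks the first \<open>n\<close> coordinates and
  \<open>Inr\<close> the last \<open>m\<close>.\<close>

definition vjoin :: "real^'n \<Rightarrow> real^'m \<Rightarrow> real^('n::finite + 'm::finite)"
  where "vjoin x y = (\<chi> k. case k of Inl i \<Rightarrow> x $ i | Inr j \<Rightarrow> y $ j)"

definition vfst :: "real^('n::finite + 'm::finite) \<Rightarrow> real^'n"
  where "vfst z = (\<chi> i. z $ Inl i)"

definition vsnd :: "real^('n::finite + 'm::finite) \<Rightarrow> real^'m"
  where "vsnd z = (\<chi> j. z $ Inr j)"

definition block_diag :: "real^'n^'n \<Rightarrow> real^'m^'m \<Rightarrow> real^('n::finite + 'm::finite)^('n + 'm)"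
  where "block_diag X Y = (\<chi> k l. case k of
      Inl i \<Rightarrow> (case l of Inl i' \<Rightarrow> X $ i $ i' | Inr j' \<Rightarrow> 0)
    | Inr j \<Rightarrow> (case l of Inl i' \<Rightarrow> 0 | Inr j' \<Rightarrow> Y $ j $ j'))"

definition T_PD ::
  "real^'n^'m \<Rightarrow> (real^'n \<Rightarrow> (real^'n) set) \<Rightarrow> (real^'m \<Rightarrow> (real^'m) set) \<Rightarrow>
    real^('n::finite + 'm::finite) \<Rightarrow> (real^('n::finite + 'm::finite)) set"
  where "T_PD L A B z =
    {vjoin (a + transpose L *v vsnd z) (b - L *v vfst z) | a b.
      a \<in> A (vfst z) \<and> b \<in> inv_op B (vsnd z)}"


section \<open>Semimonotonicity and oblique weak Minty solutions\<close>

definition semimonotone_at ::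
  "real^'n^'n \<Rightarrow> real^'n^'n \<Rightarrow> (real^'n \<Rightarrow> (real^'n) set) \<Rightarrow> real^'n \<Rightarrow> real^'n \<Rightarrow> bool"
  where "semimonotone_at M R A x' y' \<longleftrightarrow>
    symmetric_matrix M \<and> symmetric_matrix R \<and> (x', y') \<in> gph A \<and>
    (\<forall>(x, y) \<in> gph A.
      (x - x') \<bullet> (y - y') \<ge> (x - x') \<bullet> (M *v (x - x')) + (y - y') \<bullet> (R *v (y - y')))"

definition oblique_weak_minty ::
  "real^'k^'k \<Rightarrow> (real^'k \<Rightarrow> (real^'k) set) \<Rightarrow> (real^'k) set \<Rightarrow> bool"
  where "oblique_weak_minty V T S \<longleftrightarrow>
    symmetric_matrix V \<and> S \<noteq> {} \<and> S \<subseteq> zer T \<and>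
    (\<forall>zs \<in> S. \<forall>(z, v) \<in> gph T. v \<bullet> (z - zs) \<ge> v \<bullet> (V *v v))"

end

theory Submission
  imports Defs
begin

text \<open>
  Write \<open>v = (a + L\<^sup>T y, b - L x)\<close> with \<open>a \<in> A x\<close> and \<open>y \<in> B b\<close>. The cross terms cancel, so
  \<open>\<langle>v, z - z\<^sup>\<star>\<rangle> = \<langle>a + L\<^sup>T y\<^sup>\<star>, x - x\<^sup>\<star>\<rangle> + \<langle>b - L x\<^sup>\<star>, y - y\<^sup>\<star>\<rangle>\<close>, and semimonotonicity bounds this below by
  four quadratic forms. The range conditions let the primed forms see only \<open>v\<close>; the
  others pair up, since \<open>v\<close> splits as \<open>(a + L\<^sup>T y\<^sup>\<star>) + L\<^sup>T (y - y\<^sup>\<star>)\<close> and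
  \<open>(b - L x\<^sup>\<star>) - L (x - x\<^sup>\<star>)\<close>, and the parallel sum is the infimal convolution of quadratic forms.
\<close>

lemma inner_matrix_vector_transpose:
  fixes X :: "real^'n^'m"
  shows "(X *v u) \<bullet> w = u \<bullet> (transpose X *v w)"
  by (metis dot_lmul_matrix inner_commute transpose_matrix_vector)

lemma symmetric_matrix_inner:
  "symmetric_matrix X \<Longrightarrow> (X *v u) \<bullet> w = u \<bullet> (X *v w)"
  by (simp add: inner_matrix_vector_transpose symmetric_matrix_def)

lemma transpose_plus: "transpose (X + Y) = transpose X + transpose Y"
  by (simp add: transpose_def vec_eq_iff)

lemma transpose_minus: "transpose (X - Y) = transpose X - transpose Y"
  by (simp add: transpose_def vec_eq_iff)

lemma symmetric_matrix_plus:
  "symmetric_matrix X \<Longrightarrow> symmetric_matrix Y \<Longrightarrow> symmetric_matrix (X + Y)"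
  by (simp add: symmetric_matrix_def transpose_plus)

text \<open>Transposing the Penrose equations of a symmetric \<open>X\<close> turns them into those
  of \<open>X\<close> for \<open>transpose (pinv X)\<close>, the two symmetry conditions trading
  places; uniqueness then applies.\<close>

lemma symmetric_matrix_pinv:
  assumes "symmetric_matrix X"
  shows "symmetric_matrix (pinv X)"
proof -
  have X: "transpose X = X" using assms by (simp add: symmetric_matrix_def)
  have p: "X ** pinv X ** X = X" "pinv X ** X ** pinv X = pinv X"
      "transpose (X ** pinv X) = X ** pinv X" "transpose (pinv X ** X) = pinv X ** X"
    using is_pinv_pinv[of X] by (auto simp: is_pinv_def)
  let ?Q = "transpose (pinv X)"
  have c: "X ** ?Q = pinv X ** X" "?Q ** X = X ** pinv X"
    using p(3,4) by (simp_all add: matrix_transpose_mul X)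
  have "X ** ?Q ** X = X"
    using arg_cong[OF p(1), of transpose] by (simp add: matrix_transpose_mul X matrix_mul_assoc)
  moreover have "?Q ** X ** ?Q = ?Q"
    using arg_cong[OF p(2), of transpose] by (simp add: matrix_transpose_mul X matrix_mul_assoc)
  moreover have "transpose (X ** ?Q) = X ** ?Q" "transpose (?Q ** X) = ?Q ** X"
    unfolding c by (simp_all add: p)
  ultimately have "is_pinv X ?Q"
    by (simp add: is_pinv_def)
  then show ?thesis
    using is_pinv_unique is_pinv_pinv unfolding symmetric_matrix_def by blast
qed

text \<open>\<open>(X + Y) ** pinv (X + Y)\<close> fixes the range of \<open>X + Y\<close>. That
  range contains the range of \<open>X\<close> by assumption, hence also that of
  \<open>Y = (X + Y) - X\<close>.\<close>

lemma parallel_summable_pinv_mult: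
  assumes "parallel_summable X Y"
  shows "(X + Y) *v (pinv (X + Y) *v (Y *v u)) = Y *v u"
proof -
  have "X *v u \<in> mrange (X + Y)"
    using assms by (auto simp: parallel_summable_def mrange_def)
  then obtain w where w: "X *v u = (X + Y) *v w"
    by (auto simp: mrange_def)
  then have "Y *v u = (X + Y) *v (u - w)"
    by (simp add: matrix_vector_mult_diff_distrib matrix_vector_mult_add_rdistrib)
  moreover have "(X + Y) ** pinv (X + Y) ** (X + Y) = X + Y"
    using is_pinv_pinv[of "X + Y"] by (simp add: is_pinv_def)
  ultimately show ?thesis
    by (metis matrix_vector_mul_assoc)
qed

text \<open>Put \<open>X = (X + Y) - Y\<close> into the definition. Unlike
  \<open>X ** pinv (X + Y) ** Y\<close>, the resulting form is visibly symmetric when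
  \<open>X\<close> and \<open>Y\<close> are.\<close>

lemma parallel_sum_vector:
  assumes "parallel_summable X Y"
  shows "(X \<box> Y) *v u = Y *v u - Y *v (pinv (X + Y) *v (Y *v u))"
  using parallel_summable_pinv_mult[OF assms, of u]
  by (simp add: parallel_sum_def matrix_vector_mult_add_rdistrib algebra_simps
      flip: matrix_vector_mul_assoc)

lemma symmetric_matrix_parallel_sum:
  assumes "(X, Y) \<in> dom_box"
  shows "symmetric_matrix (X \<box> Y)"
proof -
  have X: "symmetric_matrix X" and Y: "symmetric_matrix Y" and s: "parallel_summable X Y"
    using assms by (auto simp: dom_box_def)
  have eq: "X \<box> Y = Y - Y ** pinv (X + Y) ** Y"
    by (simp add: matrix_eq parallel_sum_vector[OF s] matrix_vector_mult_diff_rdistrib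
        flip: matrix_vector_mul_assoc)
  have "symmetric_matrix (pinv (X + Y))"
    by (intro symmetric_matrix_pinv symmetric_matrix_plus X Y)
  then show ?thesis
    unfolding eq using Y
    by (simp add: symmetric_matrix_def transpose_minus matrix_transpose_mul matrix_mul_assoc)
qed

lemma parallel_sum_le:
  assumes "(X, Y) \<in> dom_box"
  shows "(u + w) \<bullet> ((X \<box> Y) *v (u + w)) \<le> u \<bullet> (X *v u) + w \<bullet> (Y *v w)"
proof -
  have Y: "symmetric_matrix Y" and s: "parallel_summable X Y"
    and psd: "psd (X + Y)"
    using assms by (auto simp: dom_box_def)
  have sym: "symmetric_matrix (X + Y)" using psd by (simp add: psd_def)
  define c where "c = u + w"
  \<comment> \<open>\<open>u\<^sub>0\<close> minimises \<open>u \<mapsto> \<langle>u, X u\<rangle> + \<langle>c - u, Y (c - u)\<rangle>\<close>; complete the square around it.\<close>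
  define u\<^sub>0 where "u\<^sub>0 = pinv (X + Y) *v (Y *v c)"
  have u\<^sub>0: "(X + Y) *v u\<^sub>0 = Y *v c"
    unfolding u\<^sub>0_def by (rule parallel_summable_pinv_mult[OF s])
  have cu: "c \<bullet> (Y *v t) = t \<bullet> (Y *v c)" for t
    by (metis Y symmetric_matrix_inner inner_commute)
  have "u \<bullet> (X *v u) + w \<bullet> (Y *v w)
      = u \<bullet> ((X + Y) *v u) - 2 * (u \<bullet> (Y *v c)) + c \<bullet> (Y *v c)"
  proof -
    have w: "w = c - u" by (simp add: c_def)
    show ?thesis
      unfolding w
      by (simp add: matrix_vector_mult_diff_distrib matrix_vector_mult_add_rdistrib
          inner_diff_left inner_diff_right inner_add_right cu[of u])
  qed
  \<comment> \<open>This is the value of the quadratic function at its minimiser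
    \<open>u\<^sub>0\<close>.\<close>
  moreover have "c \<bullet> ((X \<box> Y) *v c) = c \<bullet> (Y *v c) - u\<^sub>0 \<bullet> (Y *v c)"
    by (simp add: parallel_sum_vector[OF s] inner_diff_right cu[of u\<^sub>0] flip: u\<^sub>0_def)
  moreover have "(u - u\<^sub>0) \<bullet> ((X + Y) *v (u - u\<^sub>0))
      = u \<bullet> ((X + Y) *v u) - 2 * (u \<bullet> (Y *v c)) + u\<^sub>0 \<bullet> (Y *v c)"
  proof -
    have "u\<^sub>0 \<bullet> ((X + Y) *v u) = u \<bullet> (Y *v c)"
      by (metis sym symmetric_matrix_inner inner_commute u\<^sub>0)
    then show ?thesis
      by (simp add: matrix_vector_mult_diff_distrib inner_diff_left inner_diff_right u\<^sub>0)
  qed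
  moreover have "0 \<le> (u - u\<^sub>0) \<bullet> ((X + Y) *v (u - u\<^sub>0))"
    using psd by (simp add: psd_def)
  ultimately show ?thesis
    by (simp flip: c_def)
qed

lemma sum_UNIV_sum:
  fixes f :: "'n::finite + 'm::finite \<Rightarrow> 'a::comm_monoid_add"
  shows "sum f UNIV = (\<Sum>i\<in>UNIV. f (Inl i)) + (\<Sum>j\<in>UNIV. f (Inr j))"
  using sum.Plus[of UNIV UNIV f] by simp

lemma vfst_vjoin [simp]: "vfst (vjoin x y) = x"
  and vsnd_vjoin [simp]: "vsnd (vjoin x y) = y"
  by (simp_all add: vfst_def vsnd_def vjoin_def vec_eq_iff)

lemma vjoin_vfst_vsnd [simp]: "vjoin (vfst z) (vsnd z) = z"
  by (simp add: vfst_def vsnd_def vjoin_def vec_eq_iff split: sum.split)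

lemma vfst_diff: "vfst (z - w) = vfst z - vfst w"
  and vsnd_diff: "vsnd (z - w) = vsnd z - vsnd w"
  by (simp_all add: vfst_def vsnd_def vec_eq_iff)

lemma inner_vjoin: "vjoin x y \<bullet> z = x \<bullet> vfst z + y \<bullet> vsnd z"
  by (simp add: inner_vec_def sum_UNIV_sum vjoin_def vfst_def vsnd_def)

lemma block_diag_vjoin: "block_diag X Y *v vjoin x y = vjoin (X *v x) (Y *v y)"
  by (simp add: vec_eq_iff matrix_vector_mult_def block_diag_def vjoin_def sum_UNIV_sum
      split: sum.split)

lemma symmetric_matrix_block_diag:
  assumes "symmetric_matrix X" and "symmetric_matrix Y"
  shows "symmetric_matrix (block_diag X Y)"
  using assms
  by (simp add: symmetric_matrix_def vec_eq_iff transpose_def block_diag_def split: sum.split)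

text \<open>The kernel of a symmetric \<open>R\<close> is the orthogonal complement of its range, so
  it contains the complement of the kernel of \<open>K\<close>, which is the range of
  \<open>transpose K\<close>.\<close>

lemma symmetric_matrix_annihilates:
  fixes K :: "real^'n^'m"
  assumes "symmetric_matrix R" and "mrange R \<subseteq> mker K"
  shows "R *v (transpose K *v y) = 0"
proof -
  have "w \<bullet> (R *v (transpose K *v y)) = (K *v (R *v w)) \<bullet> y" for w
    by (simp add: assms(1) inner_matrix_vector_transpose flip: symmetric_matrix_inner)
  moreover have "K *v (R *v w) = 0" for w
    using assms(2) by (auto simp: mrange_def mker_def)
  ultimately show ?thesis
    by (metis inner_zero_left inner_eq_zero_iff)
qed

text \<open>By symmetry both cross terms vanish along with the term in \<open>d\<close>. This lets
  the primed forms be evaluated at the components of \<open>v\<close> instead of at \<open>r\<close>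
  and \<open>q\<close>.\<close>

lemma quadratic_form_annihilated:
  assumes R: "symmetric_matrix R" and d: "R *v d = 0"
  shows "(r + d) \<bullet> (R *v (r + d)) = r \<bullet> (R *v r)"
proof -
  have "d \<bullet> (R *v r) = 0"
    by (metis R d inner_zero_left symmetric_matrix_inner)
  then show ?thesis
    by (simp add: matrix_vector_right_distrib d inner_add_left)
qed

theorem theorem5p1:
  fixes L :: "real^'n^'m"
    and A :: "real^'n \<Rightarrow> (real^'n) set"
    and B :: "real^'m \<Rightarrow> (real^'m) set"
    and S :: "(real^('n + 'm)) set"
    and R_A R_A' R_B :: "real^'n^'n"
    and M_A M_B M_B' :: "real^'m^'m"
  assumes "L \<noteq> 0"
    and "S \<noteq> {}" and "S \<subseteq> zer (T_PD L A B)"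
    and "symmetric_matrix R_A" and "symmetric_matrix R_A'" and "symmetric_matrix R_B"
    and "symmetric_matrix M_A" and "symmetric_matrix M_B" and "symmetric_matrix M_B'"
    and "mrange R_A \<subseteq> mrange (transpose L)" and "mrange R_A' \<subseteq> mker L"
    and "mrange M_B \<subseteq> mrange L" and "mrange M_B' \<subseteq> mker (transpose L)"
    and "(M_A, M_B) \<in> dom_box" and "(R_A, R_B) \<in> dom_box"
    and "\<And>xs ys. vjoin xs ys \<in> S \<Longrightarrow>
      semimonotone_at (transpose L ** M_A ** L) (R_A + R_A') A xs (- (transpose L *v ys))"
    and "\<And>xs ys. vjoin xs ys \<in> S \<Longrightarrow>
      semimonotone_at (M_B + M_B') (L ** R_B ** transpose L) B (L *v xs) ys"
  shows "oblique_weak_minty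
    (block_diag (R_A \<box> R_B + R_A') (M_A \<box> M_B + M_B')) (T_PD L A B) S"
proof -
  let ?R = "R_A \<box> R_B + R_A'" and ?M = "M_A \<box> M_B + M_B'"
  have "v \<bullet> (z - zs) \<ge> v \<bullet> (block_diag ?R ?M *v v)"
    if zs: "zs \<in> S" and v: "(z, v) \<in> gph (T_PD L A B)" for zs z v
  proof -
    obtain a b where a: "(vfst z, a) \<in> gph A" and b: "(b, vsnd z) \<in> gph B"
      and v_eq: "v = vjoin (a + transpose L *v vsnd z) (b - L *v vfst z)"
      using v by (auto simp: gph_def T_PD_def inv_op_def)
    define dx where "dx = vfst z - vfst zs"
    define dy where "dy = vsnd z - vsnd zs"
    \<comment> \<open>\<open>r\<close> is the output increment of \<open>A\<close> relative to
      \<open>- (transpose L *v vsnd zs)\<close>, and \<open>q\<close> the input increment of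
      \<open>B\<close> relative to \<open>L *v vfst zs\<close>.\<close>
    define r where "r = a + transpose L *v vsnd zs"
    define q where "q = b - L *v vfst zs"
    have v1: "a + transpose L *v vsnd z = r + transpose L *v dy"
      by (simp add: r_def dy_def matrix_vector_mult_diff_distrib)
    have v2: "b - L *v vfst z = q + L *v (- dx)"
      by (simp add: q_def dx_def matrix_vector_mult_diff_distrib)
    have "semimonotone_at (transpose L ** M_A ** L) (R_A + R_A') A
        (vfst zs) (- (transpose L *v vsnd zs))"
      using assms(16)[of "vfst zs" "vsnd zs"] zs by simp
    then have "dx \<bullet> r \<ge> dx \<bullet> ((transpose L ** M_A ** L) *v dx) + r \<bullet> ((R_A + R_A') *v r)"
      using a by (fastforce simp: semimonotone_at_def dx_def r_def)
    \<comment> \<open>A quadratic form is even; the sign is chosen to match the summand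
      \<open>L *v (- dx)\<close> of the second component of \<open>v\<close>.\<close>
    moreover have "dx \<bullet> ((transpose L ** M_A ** L) *v dx)
        = (L *v (- dx)) \<bullet> (M_A *v (L *v (- dx)))"
      by (simp add: inner_matrix_vector_transpose matrix_vector_mul_assoc[symmetric]
          vec.neg)
    ultimately have A: "dx \<bullet> r \<ge> (L *v (- dx)) \<bullet> (M_A *v (L *v (- dx)))
        + r \<bullet> (R_A *v r) + r \<bullet> (R_A' *v r)"
      by (simp add: matrix_vector_mult_add_rdistrib inner_add_right)
    have "semimonotone_at (M_B + M_B') (L ** R_B ** transpose L) B (L *v vfst zs) (vsnd zs)"
      using assms(17)[of "vfst zs" "vsnd zs"] zs by simp
    then have "q \<bullet> dy \<ge> q \<bullet> ((M_B + M_B') *v q) + dy \<bullet> ((L ** R_B ** transpose L) *v dy)"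
      using b by (fastforce simp: semimonotone_at_def dy_def q_def)
    moreover have "dy \<bullet> ((L ** R_B ** transpose L) *v dy)
        = (transpose L *v dy) \<bullet> (R_B *v (transpose L *v dy))"
      by (simp only: inner_matrix_vector_transpose transpose_transpose
          matrix_vector_mul_assoc matrix_mul_assoc)
    ultimately have B: "q \<bullet> dy \<ge> q \<bullet> (M_B *v q) + q \<bullet> (M_B' *v q)
        + (transpose L *v dy) \<bullet> (R_B *v (transpose L *v dy))"
      by (simp add: matrix_vector_mult_add_rdistrib inner_add_right)
    have "R_A' *v (transpose L *v dy) = 0"
      by (rule symmetric_matrix_annihilates) (use assms in auto)
    then have RA': "(r + transpose L *v dy) \<bullet> (R_A' *v (r + transpose L *v dy)) = r \<bullet> (R_A' *v r)"
      by (rule quadratic_form_annihilated[OF \<open>symmetric_matrix R_A'\<close>])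
    have "M_B' *v (L *v (- dx)) = 0"
      using symmetric_matrix_annihilates[of M_B' "transpose L" "- dx"] assms by simp
    then have MB': "(q + L *v (- dx)) \<bullet> (M_B' *v (q + L *v (- dx))) = q \<bullet> (M_B' *v q)"
      by (rule quadratic_form_annihilated[OF \<open>symmetric_matrix M_B'\<close>])
    \<comment> \<open>Only the matrix sums are distributed. The vector sums stay whole, so that
      \<open>RA'\<close>, \<open>MB'\<close> and the parallel sum bounds match them.\<close>
    have "v \<bullet> (block_diag ?R ?M *v v)
        = (r + transpose L *v dy) \<bullet> ((R_A \<box> R_B) *v (r + transpose L *v dy)) + r \<bullet> (R_A' *v r)
        + ((q + L *v (- dx)) \<bullet> ((M_A \<box> M_B) *v (q + L *v (- dx))) + q \<bullet> (M_B' *v q))"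
      unfolding v_eq v1 v2
      by (simp only: block_diag_vjoin inner_vjoin vfst_vjoin vsnd_vjoin
          matrix_vector_mult_add_rdistrib[of _ _ "_ + _"] inner_add_right[of "_ + _" "_ *v _"] RA' MB')
    moreover note parallel_sum_le[OF \<open>(R_A, R_B) \<in> dom_box\<close>, of r "transpose L *v dy"]
    \<comment> \<open>The summands are swapped, because \<open>M_A\<close> is the form paired with
      \<open>L *v (- dx)\<close> and \<open>M_B\<close> the one paired with
      \<open>q\<close>.\<close>
    moreover have "(q + L *v (- dx)) \<bullet> ((M_A \<box> M_B) *v (q + L *v (- dx)))
        \<le> (L *v (- dx)) \<bullet> (M_A *v (L *v (- dx))) + q \<bullet> (M_B *v q)"
      using parallel_sum_le[OF \<open>(M_A, M_B) \<in> dom_box\<close>, of "L *v (- dx)" q]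
      by (simp only: add.commute)
    moreover have "v \<bullet> (z - zs) = dx \<bullet> r + q \<bullet> dy"
    proof -
      have "v \<bullet> (z - zs) = (r + transpose L *v dy) \<bullet> dx + (q + L *v (- dx)) \<bullet> dy"
        unfolding v_eq v1 v2 by (simp add: inner_vjoin vfst_diff vsnd_diff dx_def dy_def)
      \<comment> \<open>The skew coupling through \<open>L\<close> and its transpose makes the two
        cross terms cancel.\<close>
      moreover have "(L *v (- dx)) \<bullet> dy = - ((transpose L *v dy) \<bullet> dx)"
        by (metis inner_matrix_vector_transpose vec.neg inner_minus_left inner_commute)
      ultimately show ?thesis
        by (simp add: inner_add_left inner_commute[of r])
    qed
    ultimately show ?thesis
      using A B by linarith
  qed
  moreover have "symmetric_matrix (block_diag ?R ?M)"
    by (intro symmetric_matrix_block_diag symmetric_matrix_plus symmetric_matrix_parallel_sum assms)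
  ultimately show ?thesis
    using assms(2,3) by (auto simp: oblique_weak_minty_def)
qed

end
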